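(* Let $\mathbf{K}_*$ be the class of countable structures $M$ satisfying: (1) $M$ has the strong small index property; (2) for every finite $A \subseteq M$, $acl_M(A)$ is finite; (3) for every $a \in M$, $acl_M(\{ a \}) = \{ a \}$. Then for $M, N \in \mathbf{K}_*$, $Aut(M)$ and $Aut(N)$ are isomorphic as abstract groups if and only if $(Aut(M), M)$ and $(Aut(N), N)$ are isomorphic as permutation groups. Moreover, if $\pi: Aut(M) \to Aut(N)$ is an abstract group isomorphism, then there is a bijection $f: M \rightarrow N$ witnessing that $(Aut(M), M)$ and $(Aut(N), N)$ are isomorphic as permutation groups and such that $\pi(\alpha) = f \alpha f^{-1}$ for all $\alpha \in Aut(M)$.
   Context: For a structure $M$ with $G = Aut(M)$ and $A \subseteq M$, $G_{(A)}$ denotes the pointwise stabilizer and $G_{\{A\}}$ the setwise stabilizer of $A$ in the natural action of $G$ on $M$. An element $a$ is algebraic over $A \subseteq M$ if the orbit of $a$ under $G_{(A)}$ is finite; $acl_M(A)$ is the set of elements algebraic over $A$. A countable structure $M$ has the strong small index property if every subgroup of $Aut(M)$ of index less than $2^{\aleph_0}$ lies between $G_{(A)}$ and $G_{\{A\}}$ for some finite $A \subseteq M$. $(Aut(M), M)$ and $(Aut(N), N)$ are isomorphic as permutation groups if there is a bijection $f: M \to N$ such that $h \mapsto f h f^{-1}$ is an isomorphism from $Aut(M)$ onto $Aut(N)$. *)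

theory Defs
  imports
    "HOL-Algebra.Bij"
    "HOL-Algebra.Coset"
    "HOL-Algebra.Group_Action"
    "HOL-Library.Countable_Set"
    "HOL-Library.Equipollence"
begin

section \<open>First-order structures and their automorphism groups\<close>

(* A structure carries its own signature, so that two structures may be compared
   without being structures for the same language.  Constants are function symbols of
   arity 0.  Only the symbols in fun_syms and rel_syms belong to the signature; either
   set may be empty, finite or infinite. *)
record ('a, 'f, 'r) fo_struct =
  universe :: "'a set"
  fun_syms :: "'f set"
  rel_syms :: "'r set"
  fun_arity :: "'f \<Rightarrow> nat"
  rel_arity :: "'r \<Rightarrow> nat"
  fun_interp :: "'f \<Rightarrow> 'a list \<Rightarrow> 'a"
  rel_interp :: "'r \<Rightarrow> 'a list \<Rightarrow> bool"

definition tuples :: "'a set \<Rightarrow> nat \<Rightarrow> 'a list set" where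
  "tuples S n = {xs. set xs \<subseteq> S \<and> length xs = n}"

(* No condition on rel_interp is needed: a relation is only ever consulted on tuples of
   the right length over the universe. *)
definition is_fo_struct :: "('a, 'f, 'r) fo_struct \<Rightarrow> bool" where
  "is_fo_struct M \<longleftrightarrow>
     universe M \<noteq> {} \<and>
     (\<forall>c \<in> fun_syms M. \<forall>xs \<in> tuples (universe M) (fun_arity M c).
        fun_interp M c xs \<in> universe M)"

definition automorphisms :: "('a, 'f, 'r) fo_struct \<Rightarrow> ('a \<Rightarrow> 'a) set" where
  "automorphisms M =
     {g \<in> Bij (universe M).
        (\<forall>c \<in> fun_syms M. \<forall>xs \<in> tuples (universe M) (fun_arity M c).
           g (fun_interp M c xs) = fun_interp M c (map g xs)) \<and>
        (\<forall>R \<in> rel_syms M. \<forall>xs \<in> tuples (universe M) (rel_arity M R).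
           rel_interp M R xs \<longleftrightarrow> rel_interp M R (map g xs))}"

definition Aut :: "('a, 'f, 'r) fo_struct \<Rightarrow> ('a \<Rightarrow> 'a) monoid" where
  "Aut M = (BijGroup (universe M)) \<lparr>carrier := automorphisms M\<rparr>"

lemma carrier_Aut [simp]: "carrier (Aut M) = automorphisms M"
  by (simp add: Aut_def)

lemma map_in_tuples:
  assumes "g \<in> Bij S" "xs \<in> tuples S n"
  shows "map g xs \<in> tuples S n"
  using assms by (auto simp: tuples_def dest!: Bij_imp_funcset)

lemma group_Aut:
  assumes M: "is_fo_struct M"
  shows "group (Aut M)"
proof -
  let ?S = "universe M"
  interpret B: group "BijGroup ?S" by (rule group_BijGroup)
  have AB: "automorphisms M \<subseteq> Bij ?S"
    by (auto simp: automorphisms_def)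
  have closed: "fun_interp M c xs \<in> ?S"
    if "c \<in> fun_syms M" "xs \<in> tuples ?S (fun_arity M c)" for c xs
    using M that by (simp add: is_fo_struct_def)
  have "subgroup (automorphisms M) (BijGroup ?S)"
  proof (rule B.subgroupI)
    show "automorphisms M \<subseteq> carrier (BijGroup ?S)"
      using AB by (simp add: BijGroup_def)
    have id: "map (\<lambda>x\<in>?S. x) xs = xs" if "xs \<in> tuples ?S n" for xs n
      using that by (auto simp: tuples_def intro!: map_idI)
    have "(\<lambda>x\<in>?S. x) \<in> automorphisms M"
      using closed by (auto simp: automorphisms_def id_Bij id)
    then show "automorphisms M \<noteq> {}" by blast
  next
    fix g assume g: "g \<in> automorphisms M"
    then have gB: "g \<in> Bij ?S" using AB by blast
    let ?h = "\<lambda>x\<in>?S. inv_into ?S g x"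
    have hB: "?h \<in> Bij ?S" by (rule restrict_inv_into_Bij[OF gB])
    have hg: "?h (g x) = x" if "x \<in> ?S" for x
      using that gB by (auto simp: Bij_def bij_betw_def)
    have gh: "g (?h x) = x" if "x \<in> ?S" for x
      using that gB by (auto simp: Bij_def bij_betw_def f_inv_into_f)
    have mgh: "map g (map ?h xs) = xs" if "xs \<in> tuples ?S n" for xs n
      using that gh by (auto simp: tuples_def intro!: map_idI)
    have "?h \<in> automorphisms M"
      unfolding automorphisms_def
    proof (intro CollectI conjI ballI)
      show "?h \<in> Bij ?S" by (rule hB)
    next
      fix c xs assume c: "c \<in> fun_syms M" and xs: "xs \<in> tuples ?S (fun_arity M c)"
      have ys: "map ?h xs \<in> tuples ?S (fun_arity M c)"
        by (rule map_in_tuples[OF hB xs])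
      have "fun_interp M c xs = g (fun_interp M c (map ?h xs))"
        using g c ys mgh[OF xs] by (simp add: automorphisms_def)
      then show "?h (fun_interp M c xs) = fun_interp M c (map ?h xs)"
        using hg[OF closed[OF c ys]] by simp
    next
      fix R xs assume R: "R \<in> rel_syms M" and xs: "xs \<in> tuples ?S (rel_arity M R)"
      have ys: "map ?h xs \<in> tuples ?S (rel_arity M R)"
        by (rule map_in_tuples[OF hB xs])
      have "rel_interp M R (map ?h xs) = rel_interp M R (map g (map ?h xs))"
        using g R ys unfolding automorphisms_def by blast
      then show "rel_interp M R xs = rel_interp M R (map ?h xs)"
        by (simp only: mgh[OF xs])
    qed
    then show "inv\<^bsub>BijGroup ?S\<^esub> g \<in> automorphisms M"
      by (simp add: inv_BijGroup[OF gB])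
  next
    fix g h assume g: "g \<in> automorphisms M" and h: "h \<in> automorphisms M"
    then have gB: "g \<in> Bij ?S" and hB: "h \<in> Bij ?S" using AB by auto
    have mc: "map (compose ?S g h) xs = map g (map h xs)" if "xs \<in> tuples ?S n" for xs n
      using that by (auto simp: tuples_def compose_def)
    have "compose ?S g h \<in> automorphisms M"
      unfolding automorphisms_def
    proof (intro CollectI conjI ballI)
      show "compose ?S g h \<in> Bij ?S" by (rule compose_Bij[OF gB hB])
    next
      fix c xs assume c: "c \<in> fun_syms M" and xs: "xs \<in> tuples ?S (fun_arity M c)"
      have ys: "map h xs \<in> tuples ?S (fun_arity M c)"
        by (rule map_in_tuples[OF hB xs])
      have "compose ?S g h (fun_interp M c xs) = g (h (fun_interp M c xs))"
        using closed[OF c xs] by (simp add: compose_def)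
      also have "\<dots> = g (fun_interp M c (map h xs))"
        using h c xs by (simp add: automorphisms_def)
      also have "\<dots> = fun_interp M c (map g (map h xs))"
        using g c ys by (simp add: automorphisms_def)
      finally show "compose ?S g h (fun_interp M c xs) =
          fun_interp M c (map (compose ?S g h) xs)"
        by (simp only: mc[OF xs])
    next
      fix R xs assume R: "R \<in> rel_syms M" and xs: "xs \<in> tuples ?S (rel_arity M R)"
      have ys: "map h xs \<in> tuples ?S (rel_arity M R)"
        by (rule map_in_tuples[OF hB xs])
      have "rel_interp M R xs = rel_interp M R (map h xs)"
        using h R xs unfolding automorphisms_def by blast
      also have "\<dots> = rel_interp M R (map g (map h xs))"
        using g R ys unfolding automorphisms_def by blast
      finally show "rel_interp M R xs = rel_interp M R (map (compose ?S g h) xs)"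
        by (simp only: mc[OF xs])
    qed
    then show "g \<otimes>\<^bsub>BijGroup ?S\<^esub> h \<in> automorphisms M"
      using gB hB by (simp add: BijGroup_def)
  qed
  then show ?thesis
    using B.subgroup_imp_group by (simp add: Aut_def)
qed


section \<open>Stabilizers, algebraic closure, the strong small index property\<close>

definition pointwise_stab :: "('a, 'f, 'r) fo_struct \<Rightarrow> 'a set \<Rightarrow> ('a \<Rightarrow> 'a) set" where
  "pointwise_stab M A = {g \<in> carrier (Aut M). \<forall>a \<in> A. g a = a}"

definition setwise_stab :: "('a, 'f, 'r) fo_struct \<Rightarrow> 'a set \<Rightarrow> ('a \<Rightarrow> 'a) set" where
  "setwise_stab M A = {g \<in> carrier (Aut M). g ` A = A}"

definition acl :: "('a, 'f, 'r) fo_struct \<Rightarrow> 'a set \<Rightarrow> 'a set" where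
  "acl M A =
     {a \<in> universe M.
        finite (orbit ((Aut M) \<lparr>carrier := pointwise_stab M A\<rparr>) (\<lambda>g. g) a)}"

(* The index of H is the cardinality of its set of cosets, and (UNIV :: nat set set), the
   powerset of the natural numbers, has cardinality two to the aleph_0. *)
definition strong_small_index_property :: "('a, 'f, 'r) fo_struct \<Rightarrow> bool" where
  "strong_small_index_property M \<longleftrightarrow>
     (\<forall>H. subgroup H (Aut M) \<and> rcosets\<^bsub>Aut M\<^esub> H \<prec> (UNIV :: nat set set) \<longrightarrow>
        (\<exists>A. finite A \<and> A \<subseteq> universe M \<and>
             pointwise_stab M A \<subseteq> H \<and> H \<subseteq> setwise_stab M A))"

definition K_star :: "('a, 'f, 'r) fo_struct set" where
  "K_star =
     {M. is_fo_struct M \<and> countable (universe M) \<and>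
         strong_small_index_property M \<and>
         (\<forall>A. finite A \<and> A \<subseteq> universe M \<longrightarrow> finite (acl M A)) \<and>
         (\<forall>a \<in> universe M. acl M {a} = {a})}"


section \<open>Isomorphism of permutation groups\<close>

(* The map f h f^{-1}.  Group elements are extensional functions, hence the restriction to
   the universe of the target. *)
definition conj_by ::
  "('a \<Rightarrow> 'b) \<Rightarrow> ('a, 'f, 'r) fo_struct \<Rightarrow> ('b, 'g, 's) fo_struct \<Rightarrow> ('a \<Rightarrow> 'a) \<Rightarrow> 'b \<Rightarrow> 'b" where
  "conj_by f M N h = (\<lambda>y \<in> universe N. f (h (inv_into (universe M) f y)))"

definition perm_group_iso ::
  "('a, 'f, 'r) fo_struct \<Rightarrow> ('b, 'g, 's) fo_struct \<Rightarrow> ('a \<Rightarrow> 'b) \<Rightarrow> bool" where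
  "perm_group_iso M N f \<longleftrightarrow>
     bij_betw f (universe M) (universe N) \<and> conj_by f M N \<in> iso (Aut M) (Aut N)"

end

theory Submission
  imports Defs
begin

text \<open>
  The point stabilizers are recognized inside the abstract group \<open>G = Aut(M)\<close>. Suppose \<open>M\<close> has at
  least two points. If \<open>G\<^sub>a\<close> is contained in a subgroup \<open>H\<close>, then \<open>H\<close> has countable index, hence
  \<open>G\<^sub>(\<^sub>A\<^sub>) \<le> H \<le> G\<^sub>{\<^sub>A\<^sub>}\<close> for some finite \<open>A\<close>; since \<open>G\<^sub>a\<close> permutes \<open>A\<close>, one gets
  \<open>A \<subseteq> acl {a} = {a}\<close>, so \<open>H\<close> is \<open>G\<^sub>a\<close> or \<open>G\<close>. In the same way \<open>G\<^sub>a\<close> has no proper subgroup of finite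
  index. Conversely, let \<open>H\<close> be a maximal subgroup of countable index without proper subgroups of
  finite index, and let \<open>G\<^sub>(\<^sub>A\<^sub>) \<le> H \<le> G\<^sub>{\<^sub>A\<^sub>}\<close>. As \<open>G\<^sub>(\<^sub>A\<^sub>)\<close> has finite index in \<open>H\<close>, the two are equal,
  and \<open>H \<le> G\<^sub>a\<close> for \<open>a \<in> A\<close> yields \<open>H = G\<^sub>a\<close>.

  Thus an isomorphism \<open>\<pi>\<close> permutes point stabilizers, and \<open>a \<mapsto> G\<^sub>a\<close> is injective because
  \<open>acl {a} = {a}\<close>. So \<open>\<pi> G\<^sub>a = G\<^sub>f\<^sub>(\<^sub>a\<^sub>)\<close> defines a bijection \<open>f\<close>, and conjugating by \<open>\<pi> \<alpha>\<close> gives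
  \<open>f (\<alpha> a) = \<pi> \<alpha> (f a)\<close>.
\<close>

section \<open>Cosets and group isomorphisms\<close>

text \<open>Choosing preimages under \<open>p\<close> makes \<open>q\<close> factor through
  \<open>p\<close>. In the applications at least one of the two maps sends a group element to its
  coset, so indices are compared this way.\<close>

lemma image_factor:
  assumes "\<And>x y. \<lbrakk>x \<in> X; y \<in> X; p x = p y\<rbrakk> \<Longrightarrow> q x = q y"
  obtains k where "q ` X = k ` p ` X"
proof
  show "q ` X = (\<lambda>t. q (inv_into X p t)) ` p ` X"
    unfolding image_image
  proof (rule image_cong[OF refl])
    fix x assume "x \<in> X"
    then show "q x = q (inv_into X p (p x))"
      by (intro assms) (auto simp: inv_into_into f_inv_into_f)
  qed
qed

lemma finite_image_factor:
  assumes "finite (p ` X)" "\<And>x y. \<lbrakk>x \<in> X; y \<in> X; p x = p y\<rbrakk> \<Longrightarrow> q x = q y"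
  shows "finite (q ` X)"
  using assms by (metis finite_imageI image_factor)

lemma countable_image_factor:
  assumes "countable (p ` X)" "\<And>x y. \<lbrakk>x \<in> X; y \<in> X; p x = p y\<rbrakk> \<Longrightarrow> q x = q y"
  shows "countable (q ` X)"
  using assms by (metis countable_image image_factor)

lemma rcosets_eq_image: "rcosets\<^bsub>G\<^esub> H = (\<lambda>x. H #>\<^bsub>G\<^esub> x) ` carrier G"
  by (auto simp: RCOSETS_def)

lemma (in group) rcoset_eq_iff:
  assumes L: "subgroup L G" and x: "x \<in> carrier G" and y: "y \<in> carrier G"
  shows "L #> x = L #> y \<longleftrightarrow> x \<otimes> inv y \<in> L"
proof
  assume "L #> x = L #> y"
  then have "L #> (x \<otimes> inv y) = L"
    using x y subgroup.subset[OF L] by (rule coset_mult_inv2)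
  then show "x \<otimes> inv y \<in> L" using x y by (intro coset_join1[OF _ _ L]) simp_all
next
  assume "x \<otimes> inv y \<in> L"
  then have "L #> (x \<otimes> inv y) = L" using x y L by (intro coset_join2) auto
  then show "L #> x = L #> y"
    using x y subgroup.subset[OF L] by (rule coset_mult_inv1)
qed

text \<open>The coset of an element modulo \<open>H\<close> determines its coset modulo the larger
  group \<open>K\<close>.\<close>

lemma (in group) countable_rcosets_mono:
  assumes "subgroup H G" "subgroup K G" "H \<subseteq> K" "countable (rcosets H)"
  shows "countable (rcosets K)"
  using assms(4) unfolding rcosets_eq_image
  by (rule countable_image_factor) (use assms in \<open>auto simp: rcoset_eq_iff\<close>)

text \<open>Each coset \<open>H #> t\<close> splits into finitely many cosets of \<open>L\<close>,
  the translates by \<open>t\<close> of those inside \<open>H\<close>; a countable union of finite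
  sets is countable.\<close>

lemma (in group) countable_rcosets_finite_index:
  assumes H: "subgroup H G" and L: "subgroup L G" and LH: "L \<subseteq> H"
    and countable_H: "countable (rcosets H)" and fin: "finite ((\<lambda>h. L #> h) ` H)"
  shows "countable (rcosets L)"
proof -
  have "\<exists>F. finite F \<and> (\<forall>g \<in> carrier G. H #> g = C \<longrightarrow> L #> g \<in> F)" if "C \<in> rcosets H" for C
  proof -
    obtain t where t: "t \<in> carrier G" "C = H #> t"
      using \<open>C \<in> rcosets H\<close> by (auto simp: RCOSETS_def)
    show ?thesis
    proof (intro exI[of _ "(\<lambda>D. D #> t) ` (\<lambda>h. L #> h) ` H"] conjI ballI impI)
      fix g assume g: "g \<in> carrier G" and "H #> g = C"
      then have "g \<otimes> inv t \<in> H" using t H by (simp add: rcoset_eq_iff)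
      moreover have "L #> g = (L #> (g \<otimes> inv t)) #> t"
        using g t subgroup.subset[OF L] by (simp add: coset_mult_assoc m_assoc)
      ultimately show "L #> g \<in> (\<lambda>D. D #> t) ` (\<lambda>h. L #> h) ` H" by blast
    qed (use fin in simp)
  qed
  then obtain F where F: "\<And>C. C \<in> rcosets H \<Longrightarrow> finite (F C)"
    "\<And>C g. \<lbrakk>C \<in> rcosets H; g \<in> carrier G; H #> g = C\<rbrakk> \<Longrightarrow> L #> g \<in> F C"
    by metis
  have "rcosets L \<subseteq> (\<Union>C \<in> rcosets H. F C)"
    using F(2) by (fastforce simp: RCOSETS_def)
  moreover have "countable (\<Union>C \<in> rcosets H. F C)"
    using countable_H F(1) by (intro countable_UN) (auto intro: countable_finite)
  ultimately show ?thesis by (rule countable_subset)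
qed

section \<open>Transport of subgroups and cosets along isomorphisms\<close>

lemma iso_image_subgroup:
  assumes "group G" "group G'" "h \<in> iso G G'" "subgroup H G"
  shows "subgroup (h ` H) G'"
proof -
  interpret group_hom G G' h
    using assms by (simp add: group_hom_def group_hom_axioms_def iso_imp_homomorphism)
  show ?thesis using assms(4) by (rule subgroup_img_is_subgroup)
qed

lemma iso_image_rcoset:
  assumes "h \<in> iso G G'" "L \<subseteq> carrier G" "x \<in> carrier G"
  shows "h ` L #>\<^bsub>G'\<^esub> h x = h ` (L #>\<^bsub>G\<^esub> x)"
proof -
  have "h (l \<otimes>\<^bsub>G\<^esub> x) = h l \<otimes>\<^bsub>G'\<^esub> h x" if "l \<in> L" for l
    using assms that by (auto simp: iso_def hom_def)
  then show ?thesis by (force simp: r_coset_def)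
qed

text \<open>A general \<open>X\<close> covers both the index in the whole group and the relative
  index in a subgroup, as \<open>point_like\<close> needs both.\<close>

lemma iso_image_rcosets:
  assumes "h \<in> iso G G'" "L \<subseteq> carrier G" "X \<subseteq> carrier G"
  shows "(\<lambda>x. h ` L #>\<^bsub>G'\<^esub> x) ` (h ` X) = (\<lambda>C. h ` C) ` (\<lambda>x. L #>\<^bsub>G\<^esub> x) ` X"
  using assms by (force simp: image_image iso_image_rcoset intro!: image_cong)

lemma iso_image_inv_into:
  assumes "h \<in> iso G G'"
  shows "L \<subseteq> carrier G' \<Longrightarrow> h ` inv_into (carrier G) h ` L = L"
    and "K \<subseteq> carrier G \<Longrightarrow> inv_into (carrier G) h ` h ` K = K"
  using assms by (auto simp: iso_iff image_inv_into_cancel inv_into_image_cancel)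


section \<open>A group-theoretic description of point stabilizers\<close>

text \<open>The case \<open>H = carrier G\<close> is admitted only to cover one-point structures.\<close>

definition point_like :: "('g, 'm) monoid_scheme \<Rightarrow> 'g set \<Rightarrow> bool" where
  "point_like G H \<longleftrightarrow>
     subgroup H G \<and> countable (rcosets\<^bsub>G\<^esub> H) \<and>
     (\<forall>L. subgroup L G \<and> L \<subseteq> H \<and> finite ((\<lambda>h. L #>\<^bsub>G\<^esub> h) ` H) \<longrightarrow> L = H) \<and>
     (\<forall>K. subgroup K G \<and> H \<subseteq> K \<longrightarrow> K = H \<or> K = carrier G) \<and>
     (H = carrier G \<longrightarrow> carrier G = {\<one>\<^bsub>G\<^esub>})"

text \<open>Every clause of \<open>point_like\<close> speaks of the abstract group only. Subgroups
  \<open>L\<close> and \<open>K\<close> of \<open>G'\<close> are pulled back along the inverse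
  \<open>k\<close>, where the clauses for \<open>H\<close> apply.\<close>

lemma point_like_iso_image:
  assumes G: "group G" and G': "group G'" and h: "h \<in> iso G G'" and H: "point_like G H"
  shows "point_like G' (h ` H)"
proof -
  define k where "k = inv_into (carrier G) h"
  have k: "k \<in> iso G' G" using G h by (simp add: k_def group.iso_set_sym)
  have sub: "subgroup H G" using H by (simp add: point_like_def)
  have HG: "H \<subseteq> carrier G" using sub by (rule subgroup.subset)
  have hG: "h ` carrier G = carrier G'" and kG: "k ` carrier G' = carrier G"
    using h k by (auto simp: iso_iff)
  have hk: "h ` k ` L = L" if "L \<subseteq> carrier G'" for L
    using iso_image_inv_into[OF h] that by (simp add: k_def)
  have kh: "k ` h ` L = L" if "L \<subseteq> carrier G" for L
    using iso_image_inv_into[OF h] that by (simp add: k_def)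
  show ?thesis
    unfolding point_like_def
  proof (intro conjI allI impI)
    show "subgroup (h ` H) G'" by (rule iso_image_subgroup[OF G G' h sub])
    have "countable ((\<lambda>C. h ` C) ` (rcosets\<^bsub>G\<^esub> H))"
      using H by (simp add: point_like_def)
    then show "countable (rcosets\<^bsub>G'\<^esub> (h ` H))"
      using iso_image_rcosets[OF h HG subset_refl] by (simp add: rcosets_eq_image hG)
  next
    fix L assume L: "subgroup L G' \<and> L \<subseteq> h ` H \<and> finite ((\<lambda>x. L #>\<^bsub>G'\<^esub> x) ` (h ` H))"
    then have LG: "L \<subseteq> carrier G'" by (auto dest: subgroup.subset)
    have "finite ((\<lambda>x. k ` L #>\<^bsub>G\<^esub> x) ` (k ` h ` H))"
      using L iso_image_rcosets[OF k LG, of "h ` H"] HG hG by (metis finite_imageI image_mono)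
    moreover have "subgroup (k ` L) G" using L by (intro iso_image_subgroup[OF G' G k]) simp
    moreover have "k ` L \<subseteq> H" using L kh[OF HG] by blast
    ultimately have "k ` L = H" using H kh[OF HG] by (simp add: point_like_def)
    then show "L = h ` H" using hk[OF LG] by simp
  next
    fix K assume K: "subgroup K G' \<and> h ` H \<subseteq> K"
    then have KG: "K \<subseteq> carrier G'" by (auto dest: subgroup.subset)
    have "subgroup (k ` K) G" using K by (intro iso_image_subgroup[OF G' G k]) simp
    moreover have "H \<subseteq> k ` K" using K kh[OF HG] by blast
    ultimately have "k ` K = H \<or> k ` K = carrier G" using H by (simp add: point_like_def)
    then show "K = h ` H \<or> K = carrier G'" using hk[OF KG] hG by metis
  next
    assume "h ` H = carrier G'"
    then have "H = carrier G" using kh[OF HG] kG by simp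
    then have "carrier G = {\<one>\<^bsub>G\<^esub>}" using H by (simp add: point_like_def)
    then show "carrier G' = {\<one>\<^bsub>G'\<^esub>}"
      using hG hom_one[OF iso_imp_homomorphism[OF h] G G'] by auto
  qed
qed


section \<open>Stabilizers in automorphism groups\<close>

locale aut_structure =
  fixes M :: "('a, 'f, 'r) fo_struct"
  assumes struct: "is_fo_struct M"
begin

section \<open>Automorphisms acting on points\<close>

sublocale group "Aut M"
  using struct by (rule group_Aut)

lemma aut_Bij: "g \<in> automorphisms M \<Longrightarrow> g \<in> Bij (universe M)"
  by (simp add: automorphisms_def)

lemma aut_closed: "\<lbrakk>g \<in> automorphisms M; x \<in> universe M\<rbrakk> \<Longrightarrow> g x \<in> universe M"
  using aut_Bij Bij_imp_funcset by blast

lemma aut_mult: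
  "\<lbrakk>g \<in> automorphisms M; h \<in> automorphisms M; x \<in> universe M\<rbrakk>
    \<Longrightarrow> (g \<otimes>\<^bsub>Aut M\<^esub> h) x = g (h x)"
  by (simp add: Aut_def BijGroup_def aut_Bij compose_def)

lemma aut_one: "x \<in> universe M \<Longrightarrow> \<one>\<^bsub>Aut M\<^esub> x = x"
  by (simp add: Aut_def BijGroup_def)

lemma aut_mult_closed:
  "\<lbrakk>g \<in> automorphisms M; h \<in> automorphisms M\<rbrakk> \<Longrightarrow> g \<otimes>\<^bsub>Aut M\<^esub> h \<in> automorphisms M"
  using m_closed by simp

lemma aut_inv_closed: "g \<in> automorphisms M \<Longrightarrow> inv\<^bsub>Aut M\<^esub> g \<in> automorphisms M"
  using inv_closed by simp

lemma aut_inv_apply: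
  assumes "g \<in> automorphisms M" "x \<in> universe M"
  shows "(inv\<^bsub>Aut M\<^esub> g) (g x) = x" "g ((inv\<^bsub>Aut M\<^esub> g) x) = x"
  using assms aut_mult[of "inv\<^bsub>Aut M\<^esub> g" g x] aut_mult[of g "inv\<^bsub>Aut M\<^esub> g" x]
  by (simp_all add: aut_inv_closed aut_one)

lemma aut_ext:
  assumes "g \<in> automorphisms M" "h \<in> automorphisms M" "\<And>x. x \<in> universe M \<Longrightarrow> g x = h x"
  shows "g = h"
  using assms by (meson Bij_imp_extensional aut_Bij extensionalityI)

lemma subgroup_pointwise_stab:
  assumes "A \<subseteq> universe M"
  shows "subgroup (pointwise_stab M A) (Aut M)"
proof (rule subgroupI)
  show "pointwise_stab M A \<noteq> {}"
    using assms aut_one one_closed by (force simp: pointwise_stab_def)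
  fix g assume g: "g \<in> pointwise_stab M A"
  show "inv\<^bsub>Aut M\<^esub> g \<in> pointwise_stab M A"
    using g assms aut_inv_apply(1)[of g] by (force simp: pointwise_stab_def aut_inv_closed)
  fix h assume "h \<in> pointwise_stab M A"
  then show "g \<otimes>\<^bsub>Aut M\<^esub> h \<in> pointwise_stab M A"
    using g assms by (auto simp: pointwise_stab_def aut_mult aut_mult_closed subset_iff)
qed (auto simp: pointwise_stab_def)

section \<open>Algebraic closure and the index of stabilizers\<close>

lemma acl_mono:
  assumes "A \<subseteq> B"
  shows "acl M A \<subseteq> acl M B"
  using assms
  by (auto simp: acl_def orbit_def pointwise_stab_def elim!: rev_finite_subset)

text \<open>Right cosets agree when \<open>g h^-1\<close> fixes \<open>A\<close> pointwise, that is,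
  when the inverses of \<open>g\<close> and \<open>h\<close> agree on \<open>A\<close>. This is why
  inverses appear in the counting arguments below.\<close>

lemma rcoset_pointwise_stab_eq:
  assumes A: "A \<subseteq> universe M" and g: "g \<in> automorphisms M" and h: "h \<in> automorphisms M"
    and eq: "\<And>a. a \<in> A \<Longrightarrow> (inv\<^bsub>Aut M\<^esub> g) a = (inv\<^bsub>Aut M\<^esub> h) a"
  shows "pointwise_stab M A #>\<^bsub>Aut M\<^esub> g = pointwise_stab M A #>\<^bsub>Aut M\<^esub> h"
proof -
  have "(g \<otimes>\<^bsub>Aut M\<^esub> inv\<^bsub>Aut M\<^esub> h) a = a" if "a \<in> A" for a
  proof -
    have "a \<in> universe M" using that A by blast
    then have "(g \<otimes>\<^bsub>Aut M\<^esub> inv\<^bsub>Aut M\<^esub> h) a = g ((inv\<^bsub>Aut M\<^esub> g) a)"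
      using g h eq[OF that] by (simp add: aut_mult aut_inv_closed)
    then show ?thesis using g \<open>a \<in> universe M\<close> by (simp add: aut_inv_apply)
  qed
  then show ?thesis
    using g h subgroup_pointwise_stab[OF A]
    by (subst rcoset_eq_iff) (auto simp: pointwise_stab_def aut_mult_closed aut_inv_closed)
qed

text \<open>As in the orbit-stabilizer theorem, the coset of \<open>g\<close> is determined by the
  point \<open>g^-1 a\<close>.\<close>

lemma countable_index_point_stab:
  assumes "countable (universe M)" "a \<in> universe M"
  shows "countable (rcosets\<^bsub>Aut M\<^esub> (pointwise_stab M {a}))"
  unfolding rcosets_eq_image
proof (rule countable_image_factor[where p = "\<lambda>g. (inv\<^bsub>Aut M\<^esub> g) a"])
  have "(\<lambda>g. (inv\<^bsub>Aut M\<^esub> g) a) ` carrier (Aut M) \<subseteq> universe M"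
    using assms(2) by (auto simp: aut_inv_closed aut_closed)
  then show "countable ((\<lambda>g. (inv\<^bsub>Aut M\<^esub> g) a) ` carrier (Aut M))"
    using assms(1) by (rule countable_subset)
  fix g h assume "g \<in> carrier (Aut M)" "h \<in> carrier (Aut M)"
    and "(inv\<^bsub>Aut M\<^esub> g) a = (inv\<^bsub>Aut M\<^esub> h) a"
  then show "pointwise_stab M {a} #>\<^bsub>Aut M\<^esub> g = pointwise_stab M {a} #>\<^bsub>Aut M\<^esub> h"
    using assms(2) by (intro rcoset_pointwise_stab_eq) auto
qed

text \<open>\<open>H\<close> acts on \<open>A\<close>, and the self-map of \<open>A\<close> induced
  by \<open>h^-1\<close> determines the coset of \<open>h\<close>. Restricting makes these maps
  extensional, so they lie in a finite function space.\<close>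

lemma finite_index_pointwise_stab:
  assumes A: "finite A" "A \<subseteq> universe M"
    and H: "subgroup H (Aut M)" "H \<subseteq> setwise_stab M A"
  shows "finite ((\<lambda>h. pointwise_stab M A #>\<^bsub>Aut M\<^esub> h) ` H)"
proof (rule finite_image_factor[where p = "\<lambda>h. restrict (inv\<^bsub>Aut M\<^esub> h) A"])
  have "restrict (inv\<^bsub>Aut M\<^esub> h) A \<in> A \<rightarrow>\<^sub>E A" if "h \<in> H" for h
  proof -
    have "inv\<^bsub>Aut M\<^esub> h \<in> setwise_stab M A"
      using that H by (meson subgroup.m_inv_closed subsetD)
    then show ?thesis by (auto simp: setwise_stab_def)
  qed
  then have "(\<lambda>h. restrict (inv\<^bsub>Aut M\<^esub> h) A) ` H \<subseteq> A \<rightarrow>\<^sub>E A" by blast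
  then show "finite ((\<lambda>h. restrict (inv\<^bsub>Aut M\<^esub> h) A) ` H)"
    using A(1) by (meson finite_PiE finite_subset)
  fix g h assume "g \<in> H" "h \<in> H"
    and eq: "restrict (inv\<^bsub>Aut M\<^esub> g) A = restrict (inv\<^bsub>Aut M\<^esub> h) A"
  then have "g \<in> automorphisms M" "h \<in> automorphisms M"
    using subgroup.subset[OF H(1)] by auto
  moreover have "(inv\<^bsub>Aut M\<^esub> g) a = (inv\<^bsub>Aut M\<^esub> h) a" if "a \<in> A" for a
    using fun_cong[OF eq, of a] that by simp
  ultimately show "pointwise_stab M A #>\<^bsub>Aut M\<^esub> g = pointwise_stab M A #>\<^bsub>Aut M\<^esub> h"
    by (intro rcoset_pointwise_stab_eq A)
qed

text \<open>
  If \<open>L\<close> permutes the finite set \<open>B\<close> and has finite index in the stabilizer of \<open>A\<close>, then that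
  stabilizer moves \<open>B\<close> to finitely many sets only.
\<close>

lemma finite_index_imp_subset_acl:
  assumes A: "A \<subseteq> universe M" and B: "finite B" "B \<subseteq> universe M"
    and L: "subgroup L (Aut M)" "L \<subseteq> setwise_stab M B"
    and fin: "finite ((\<lambda>h. L #>\<^bsub>Aut M\<^esub> h) ` pointwise_stab M A)"
  shows "B \<subseteq> acl M A"
proof
  let ?H = "pointwise_stab M A"
  have H: "?H \<subseteq> automorphisms M" by (auto simp: pointwise_stab_def)
  have "finite ((\<lambda>h. (inv\<^bsub>Aut M\<^esub> h) ` B) ` ?H)"
    using fin
  proof (rule finite_image_factor)
    fix g h assume "g \<in> ?H" "h \<in> ?H" and eq: "L #>\<^bsub>Aut M\<^esub> g = L #>\<^bsub>Aut M\<^esub> h"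
    then have g: "g \<in> automorphisms M" and h: "h \<in> automorphisms M" using H by auto
    have "g \<otimes>\<^bsub>Aut M\<^esub> inv\<^bsub>Aut M\<^esub> h \<in> L" using eq g h L(1) by (simp add: rcoset_eq_iff)
    then have perm: "(g \<otimes>\<^bsub>Aut M\<^esub> inv\<^bsub>Aut M\<^esub> h) ` B = B"
      using L(2) by (auto simp: setwise_stab_def)
    \<comment> \<open>Since \<open>g h^-1\<close> permutes \<open>B\<close>, the set
      \<open>g^-1 B\<close> equals \<open>g^-1 (g h^-1 B)\<close>, which is
      \<open>h^-1 B\<close>.\<close>
    have "(inv\<^bsub>Aut M\<^esub> g) ` B = (inv\<^bsub>Aut M\<^esub> g) ` (g \<otimes>\<^bsub>Aut M\<^esub> inv\<^bsub>Aut M\<^esub> h) ` B"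
      by (simp only: perm)
    also have "\<dots> = (inv\<^bsub>Aut M\<^esub> h) ` B"
      unfolding image_image
    proof (rule image_cong[OF refl])
      fix b assume "b \<in> B"
      then have b: "b \<in> universe M" using B(2) by blast
      then show "(inv\<^bsub>Aut M\<^esub> g) ((g \<otimes>\<^bsub>Aut M\<^esub> inv\<^bsub>Aut M\<^esub> h) b) = (inv\<^bsub>Aut M\<^esub> h) b"
        using g h by (simp add: aut_mult aut_inv_closed aut_inv_apply aut_closed)
    qed
    finally show "(inv\<^bsub>Aut M\<^esub> g) ` B = (inv\<^bsub>Aut M\<^esub> h) ` B" .
  qed
  then have fin': "finite (\<Union>h \<in> ?H. (inv\<^bsub>Aut M\<^esub> h) ` B)"
    using B(1) by auto
  fix b assume b: "b \<in> B"
  \<comment> \<open>The stabilizer is closed under inverses, so the union over inverses contains the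
    whole orbit of \<open>b\<close>.\<close>
  have "g b \<in> (\<Union>h \<in> ?H. (inv\<^bsub>Aut M\<^esub> h) ` B)" if g: "g \<in> ?H" for g
  proof -
    have "inv\<^bsub>Aut M\<^esub> g \<in> ?H"
      using g subgroup_pointwise_stab[OF A] by (simp add: subgroup.m_inv_closed)
    moreover have "inv\<^bsub>Aut M\<^esub> (inv\<^bsub>Aut M\<^esub> g) = g" using g H by (intro inv_inv) auto
    ultimately show ?thesis using b by (intro UN_I) auto
  qed
  then have "finite (orbit (Aut M\<lparr>carrier := ?H\<rparr>) (\<lambda>g. g) b)"
    by (intro finite_subset[OF _ fin']) (auto simp: orbit_def)
  then show "b \<in> acl M A" using b B(2) by (auto simp: acl_def)
qed

text \<open>The conjugate sends \<open>g a\<close> to \<open>g (h a)\<close>, and \<open>g\<close>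
  is injective. Applied in both \<open>M\<close> and \<open>N\<close>, this yields the equivariance
  of the reconstructed bijection.\<close>

lemma conj_mem_pointwise_stab_iff:
  assumes a: "a \<in> universe M" and g: "g \<in> automorphisms M" and h: "h \<in> automorphisms M"
  shows "g \<otimes>\<^bsub>Aut M\<^esub> h \<otimes>\<^bsub>Aut M\<^esub> inv\<^bsub>Aut M\<^esub> g \<in> pointwise_stab M {g a}
    \<longleftrightarrow> h \<in> pointwise_stab M {a}"
proof -
  have "(g \<otimes>\<^bsub>Aut M\<^esub> h \<otimes>\<^bsub>Aut M\<^esub> inv\<^bsub>Aut M\<^esub> g) (g a) = g (h a)"
    using assms by (simp add: aut_mult aut_mult_closed aut_inv_closed aut_inv_apply aut_closed)
  moreover have "g (h a) = g a \<longleftrightarrow> h a = a"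
    using a g h aut_inv_apply(1)[OF g] by (metis aut_closed)
  ultimately show ?thesis
    using g h by (simp add: pointwise_stab_def aut_mult_closed aut_inv_closed)
qed

end

section \<open>Point-like subgroups of structures in \<open>K_star\<close>\<close>

locale K_star_structure =
  fixes M :: "('a, 'f, 'r) fo_struct"
  assumes K_star: "M \<in> K_star"

sublocale K_star_structure \<subseteq> aut_structure
  using K_star by unfold_locales (simp add: K_star_def)

context K_star_structure
begin

lemma acl_singleton: "a \<in> universe M \<Longrightarrow> acl M {a} = {a}"
  using K_star by (simp add: K_star_def)

lemma countable_universe: "countable (universe M)"
  using K_star by (simp add: K_star_def)

text \<open>By Cantor's theorem a countable index is below the continuum, so the strong small index
  property applies.\<close>

lemma countable_index_between:
  assumes H: "subgroup H (Aut M)" and "countable (rcosets\<^bsub>Aut M\<^esub> H)"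
  obtains A where "finite A" "A \<subseteq> universe M" "pointwise_stab M A \<subseteq> H" "H \<subseteq> setwise_stab M A"
proof -
  have "rcosets\<^bsub>Aut M\<^esub> H \<lesssim> (UNIV :: nat set)"
    using assms(2) by (auto simp: lepoll_def countable_def)
  also have "(UNIV :: nat set) \<prec> (UNIV :: nat set set)"
    using lesspoll_Pow_self[of "UNIV :: nat set"] by simp
  finally have "rcosets\<^bsub>Aut M\<^esub> H \<prec> (UNIV :: nat set set)" .
  then show thesis
    using K_star H that by (auto simp: K_star_def strong_small_index_property_def)
qed

text \<open>The stabilizer of \<open>a\<close> also fixes \<open>b\<close>, so \<open>b\<close> lies
  in \<open>acl M {a} = {a}\<close>.\<close>

lemma point_stab_inject:
  assumes a: "a \<in> universe M" and b: "b \<in> universe M"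
    and eq: "pointwise_stab M {a} = pointwise_stab M {b}"
  shows "a = b"
proof -
  have "orbit (Aut M\<lparr>carrier := pointwise_stab M {a}\<rparr>) (\<lambda>g. g) b \<subseteq> {b}"
    unfolding eq by (auto simp: orbit_def pointwise_stab_def)
  then have "b \<in> acl M {a}" using b finite_subset by (fastforce simp: acl_def)
  then show ?thesis using acl_singleton[OF a] by simp
qed

text \<open>A point fixed by every automorphism is in \<open>acl M {}\<close>, hence in
  \<open>acl M {b} = {b}\<close> for every \<open>b\<close>; so the universe is a single
  point.\<close>

lemma point_stab_eq_carrier:
  assumes a: "a \<in> universe M" and eq: "pointwise_stab M {a} = carrier (Aut M)"
  shows "carrier (Aut M) = {\<one>\<^bsub>Aut M\<^esub>}"
proof -
  have "orbit (Aut M\<lparr>carrier := pointwise_stab M {}\<rparr>) (\<lambda>g. g) a \<subseteq> {a}"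
    using eq by (auto simp: orbit_def pointwise_stab_def)
  then have "a \<in> acl M {}" using a finite_subset by (fastforce simp: acl_def)
  then have single: "b = a" if "b \<in> universe M" for b
    using acl_mono[of "{}" "{b}"] acl_singleton[OF that] by auto
  have "g = \<one>\<^bsub>Aut M\<^esub>" if g: "g \<in> automorphisms M" for g
  proof (rule aut_ext[OF g])
    show "\<one>\<^bsub>Aut M\<^esub> \<in> automorphisms M" using one_closed by simp
    fix x assume x: "x \<in> universe M"
    then show "g x = \<one>\<^bsub>Aut M\<^esub> x"
      using single[OF x] single[OF aut_closed[OF g x]] by (simp add: aut_one)
  qed
  then show ?thesis using one_closed unfolding carrier_Aut by blast
qed

lemma point_like_point_stab:
  assumes a: "a \<in> universe M"
  shows "point_like (Aut M) (pointwise_stab M {a})"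
  unfolding point_like_def
proof (intro conjI allI impI)
  let ?H = "pointwise_stab M {a}"
  have H: "subgroup ?H (Aut M)" using a by (simp add: subgroup_pointwise_stab)
  have cH: "countable (rcosets\<^bsub>Aut M\<^esub> ?H)"
    using countable_universe a by (rule countable_index_point_stab)
  show "subgroup ?H (Aut M)" by (rule H)
  show "countable (rcosets\<^bsub>Aut M\<^esub> ?H)" by (rule cH)
  show "carrier (Aut M) = {\<one>\<^bsub>Aut M\<^esub>}" if "?H = carrier (Aut M)"
    using a that by (rule point_stab_eq_carrier)
  fix L assume L: "subgroup L (Aut M) \<and> L \<subseteq> ?H \<and> finite ((\<lambda>h. L #>\<^bsub>Aut M\<^esub> h) ` ?H)"
  then have "countable (rcosets\<^bsub>Aut M\<^esub> L)"
    using countable_rcosets_finite_index H cH by blast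
  then obtain B where B: "finite B" "B \<subseteq> universe M"
    "pointwise_stab M B \<subseteq> L" "L \<subseteq> setwise_stab M B"
    using L countable_index_between by blast
  \<comment> \<open>\<open>L\<close> permutes \<open>B\<close> and has finite index in
    \<open>?H\<close>. As \<open>acl M {a} = {a}\<close>, the stabilizer of \<open>a\<close> fixes
    \<open>B\<close> pointwise and so lies in \<open>L\<close>.\<close>
  then have "B \<subseteq> acl M {a}" using a L by (intro finite_index_imp_subset_acl) auto
  then have "?H \<subseteq> pointwise_stab M B" using acl_singleton[OF a] by (auto simp: pointwise_stab_def)
  then show "L = ?H" using B(3) L by blast
next
  let ?H = "pointwise_stab M {a}"
  have H: "subgroup ?H (Aut M)" using a by (simp add: subgroup_pointwise_stab)
  fix K assume K: "subgroup K (Aut M) \<and> ?H \<subseteq> K"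
  then have "countable (rcosets\<^bsub>Aut M\<^esub> K)"
    using H countable_index_point_stab[OF countable_universe a] countable_rcosets_mono by blast
  then obtain B where B: "finite B" "B \<subseteq> universe M"
    "pointwise_stab M B \<subseteq> K" "K \<subseteq> setwise_stab M B"
    using K countable_index_between by blast
  \<comment> \<open>\<open>?H\<close> has index one in itself and, lying in \<open>K\<close>,
    permutes \<open>B\<close>; the closure argument is thus applied to \<open>?H\<close> in place of
    \<open>L\<close>.\<close>
  have "(\<lambda>h. ?H #>\<^bsub>Aut M\<^esub> h) ` ?H \<subseteq> {?H}"
    using coset_join2[OF subgroup.mem_carrier[OF H] H] by blast
  then have "finite ((\<lambda>h. ?H #>\<^bsub>Aut M\<^esub> h) ` ?H)" by (rule finite_subset) simp
  then have "B \<subseteq> acl M {a}"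
    using a H B K by (intro finite_index_imp_subset_acl) auto
  \<comment> \<open>The pointwise stabilizer of the empty set is the whole group; for a singleton
    the pointwise and setwise stabilizers coincide.\<close>
  then consider "B = {}" | "B = {a}" using acl_singleton[OF a] by (auto simp: subset_singleton_iff)
  then show "K = ?H \<or> K = carrier (Aut M)"
  proof cases
    case 1
    then have "carrier (Aut M) \<subseteq> K" using B(3) by (auto simp: pointwise_stab_def)
    then show ?thesis using K subgroup.subset by blast
  next
    case 2
    then have "K \<subseteq> ?H" using B(4) by (auto simp: pointwise_stab_def setwise_stab_def)
    then show ?thesis using K by blast
  qed
qed

lemma point_like_imp_point_stab:
  assumes H: "point_like (Aut M) H"
  obtains a where "a \<in> universe M" "H = pointwise_stab M {a}"
proof -
  have sub: "subgroup H (Aut M)" and count: "countable (rcosets\<^bsub>Aut M\<^esub> H)"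
    and no_finite_index: "\<And>L. \<lbrakk>subgroup L (Aut M); L \<subseteq> H;
      finite ((\<lambda>h. L #>\<^bsub>Aut M\<^esub> h) ` H)\<rbrakk> \<Longrightarrow> L = H"
    and maximal: "\<And>K. \<lbrakk>subgroup K (Aut M); H \<subseteq> K\<rbrakk> \<Longrightarrow> K = H \<or> K = carrier (Aut M)"
    and trivial: "H = carrier (Aut M) \<Longrightarrow> carrier (Aut M) = {\<one>\<^bsub>Aut M\<^esub>}"
    using H by (simp_all add: point_like_def)
  obtain A where A: "finite A" "A \<subseteq> universe M" "pointwise_stab M A \<subseteq> H" "H \<subseteq> setwise_stab M A"
    using countable_index_between[OF sub count] .
  have HA: "pointwise_stab M A = H"
    using A sub by (intro no_finite_index subgroup_pointwise_stab finite_index_pointwise_stab)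
  \<comment> \<open>For empty \<open>A\<close> an arbitrary point is a harmless default:
    \<open>H\<close> is then the whole group, which is trivial.\<close>
  obtain a where a: "a \<in> universe M" "A \<noteq> {} \<longrightarrow> a \<in> A"
  proof (cases "A = {}")
    case True
    then show thesis using struct that by (auto simp: is_fo_struct_def)
  next
    case False
    then show thesis using A(2) that by blast
  qed
  have "H \<subseteq> pointwise_stab M {a}" if "a \<in> A"
    using that HA by (auto simp: pointwise_stab_def)
  moreover have "H = carrier (Aut M)" if "A = {}"
    using that HA by (auto simp: pointwise_stab_def)
  moreover have stab: "subgroup (pointwise_stab M {a}) (Aut M)"
    using a by (simp add: subgroup_pointwise_stab)
  \<comment> \<open>In the last two cases the group is trivial, so all its subgroups
    coincide.\<close>
  ultimately consider "pointwise_stab M {a} = H" | "H = carrier (Aut M)"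
    | "pointwise_stab M {a} = carrier (Aut M)"
    using maximal[of "pointwise_stab M {a}"] a(2) by blast
  then have "H = pointwise_stab M {a}"
  proof cases
    case 2
    then have "carrier (Aut M) = {\<one>\<^bsub>Aut M\<^esub>}" by (rule trivial)
    moreover have "\<one>\<^bsub>Aut M\<^esub> \<in> pointwise_stab M {a}" using a one_closed
      by (simp add: pointwise_stab_def aut_one)
    ultimately show ?thesis
      using 2 subgroup.subset[OF stab]
      by (metis empty_subsetI insert_subset subset_antisym)
  next
    case 3
    then have "carrier (Aut M) = {\<one>\<^bsub>Aut M\<^esub>}" using a(1) point_stab_eq_carrier by blast
    then show ?thesis using 3 subgroup.subset[OF sub] subgroup.one_closed[OF sub]
      by (metis empty_subsetI insert_subset subset_antisym)
  qed simp
  then show thesis using a(1) that by blast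
qed

end


section \<open>Reconstruction\<close>

text \<open>This gives the second claim of the theorem and, with it, the forward implication of the
  first.\<close>

lemma iso_is_conj_by:
  fixes M :: "('a, 'f, 'r) fo_struct" and N :: "('b, 'g, 's) fo_struct"
  assumes MK: "M \<in> K_star" and NK: "N \<in> K_star" and \<pi>: "\<pi> \<in> iso (Aut M) (Aut N)"
  obtains f where "perm_group_iso M N f"
    "\<And>\<alpha>. \<alpha> \<in> carrier (Aut M) \<Longrightarrow> \<pi> \<alpha> = conj_by f M N \<alpha>"
proof -
  interpret M: K_star_structure M by unfold_locales (rule MK)
  interpret N: K_star_structure N by unfold_locales (rule NK)
  interpret \<pi>: group_hom "Aut M" "Aut N" \<pi>
    using \<pi> by unfold_locales (rule iso_imp_homomorphism)
  define \<rho> where "\<rho> = inv_into (carrier (Aut M)) \<pi>"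
  have \<rho>: "\<rho> \<in> iso (Aut N) (Aut M)" using \<pi> unfolding \<rho>_def by (rule M.iso_set_sym)
  have \<pi>_inj: "inj_on \<pi> (automorphisms M)" and \<pi>_surj: "\<pi> ` automorphisms M = automorphisms N"
    using \<pi> by (simp_all add: iso_iff)
  have \<pi>_aut: "\<pi> \<alpha> \<in> automorphisms N" if "\<alpha> \<in> automorphisms M" for \<alpha>
    using that \<pi>_surj by blast
  have stab_sub: "pointwise_stab M A \<subseteq> automorphisms M" for A
    by (auto simp: pointwise_stab_def)
  have "\<exists>b \<in> universe N. \<pi> ` pointwise_stab M {a} = pointwise_stab N {b}"
    if "a \<in> universe M" for a
    using N.point_like_imp_point_stab
      point_like_iso_image[OF M.is_group N.is_group \<pi> M.point_like_point_stab[OF that]] by metis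
  then obtain f where f: "\<And>a. a \<in> universe M \<Longrightarrow> f a \<in> universe N"
    "\<And>a. a \<in> universe M \<Longrightarrow> \<pi> ` pointwise_stab M {a} = pointwise_stab N {f a}"
    by metis
  have f_inj: "inj_on f (universe M)"
  proof (rule inj_onI)
    fix a a' assume a: "a \<in> universe M" "a' \<in> universe M" "f a = f a'"
    then have "\<pi> ` pointwise_stab M {a} = \<pi> ` pointwise_stab M {a'}" using f(2) by metis
    then have "pointwise_stab M {a} = pointwise_stab M {a'}"
      using inj_on_image_eq_iff[OF \<pi>_inj stab_sub stab_sub] by blast
    then show "a = a'" using a M.point_stab_inject by blast
  qed
  \<comment> \<open>The preimage of a point stabilizer of \<open>N\<close> is obtained by running
    the same transport along \<open>\<rho>\<close>, the inverse of \<open>\<pi>\<close>.\<close>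
  have f_surj: "b \<in> f ` universe M" if b: "b \<in> universe N" for b
  proof -
    obtain a where a: "a \<in> universe M" "\<rho> ` pointwise_stab N {b} = pointwise_stab M {a}"
      using M.point_like_imp_point_stab
        point_like_iso_image[OF N.is_group M.is_group \<rho> N.point_like_point_stab[OF b]] by metis
    have "\<pi> ` \<rho> ` pointwise_stab N {b} = pointwise_stab N {b}"
      unfolding \<rho>_def by (rule iso_image_inv_into(1)[OF \<pi>]) (auto simp: pointwise_stab_def)
    then have "pointwise_stab N {f a} = pointwise_stab N {b}" using a f(2) by metis
    then have "f a = b" using f(1) a(1) b by (intro N.point_stab_inject)
    then show ?thesis using a(1) by blast
  qed
  have f_bij: "bij_betw f (universe M) (universe N)"
    using f_inj f_surj f(1) by (auto simp: bij_betw_def)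
  \<comment> \<open>Points of \<open>N\<close> are determined by their stabilizers, so it suffices
    that the two points have the same one.\<close>
  have equivariant: "f (\<alpha> a) = \<pi> \<alpha> (f a)" if \<alpha>: "\<alpha> \<in> automorphisms M" and a: "a \<in> universe M"
    for \<alpha> a
  proof (rule N.point_stab_inject)
    have \<alpha>a: "\<alpha> a \<in> universe M" using \<alpha> a by (rule M.aut_closed)
    then show "f (\<alpha> a) \<in> universe N" by (rule f(1))
    show "\<pi> \<alpha> (f a) \<in> universe N" using \<alpha> a by (simp add: N.aut_closed \<pi>_aut f(1))
    have stab_iff: "\<pi> \<gamma> \<in> pointwise_stab N {f c} \<longleftrightarrow> \<gamma> \<in> pointwise_stab M {c}"
      if "\<gamma> \<in> automorphisms M" "c \<in> universe M" for \<gamma> c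
      unfolding f(2)[OF that(2), symmetric]
      using that(1) stab_sub by (rule inj_on_image_mem_iff[OF \<pi>_inj])
    show "pointwise_stab N {f (\<alpha> a)} = pointwise_stab N {\<pi> \<alpha> (f a)}"
    proof (rule Set.set_eqI)
      fix \<delta>
      show "\<delta> \<in> pointwise_stab N {f (\<alpha> a)} \<longleftrightarrow> \<delta> \<in> pointwise_stab N {\<pi> \<alpha> (f a)}"
      proof (cases "\<delta> \<in> automorphisms N")
        case True
        then obtain \<gamma> where \<gamma>: "\<gamma> \<in> automorphisms M" "\<delta> = \<pi> \<gamma>" using \<pi>_surj by blast
        \<comment> \<open>Chosen so that \<open>\<gamma>\<close> is the conjugate of
          \<open>\<beta>\<close> by \<open>\<alpha>\<close>: then \<open>\<gamma>\<close> fixes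
          \<open>\<alpha> a\<close> iff \<open>\<beta>\<close> fixes \<open>a\<close>, and likewise
          after applying \<open>\<pi>\<close>.\<close>
        define \<beta> where "\<beta> = inv\<^bsub>Aut M\<^esub> \<alpha> \<otimes>\<^bsub>Aut M\<^esub> \<gamma> \<otimes>\<^bsub>Aut M\<^esub> \<alpha>"
        have \<beta>: "\<beta> \<in> automorphisms M"
          using \<alpha> \<gamma> by (simp add: \<beta>_def M.aut_mult_closed M.aut_inv_closed)
        have \<gamma>_eq: "\<gamma> = \<alpha> \<otimes>\<^bsub>Aut M\<^esub> \<beta> \<otimes>\<^bsub>Aut M\<^esub> inv\<^bsub>Aut M\<^esub> \<alpha>"
          using \<alpha> \<gamma>(1)
          by (simp add: \<beta>_def M.m_assoc[symmetric] M.aut_mult_closed M.aut_inv_closed)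
            (simp add: M.m_assoc M.aut_mult_closed M.aut_inv_closed)
        have \<delta>_eq: "\<delta> = \<pi> \<alpha> \<otimes>\<^bsub>Aut N\<^esub> \<pi> \<beta> \<otimes>\<^bsub>Aut N\<^esub> inv\<^bsub>Aut N\<^esub> (\<pi> \<alpha>)"
          using \<alpha> \<beta> \<gamma>(2) \<gamma>_eq by (simp add: M.aut_mult_closed M.aut_inv_closed)
        have "\<delta> \<in> pointwise_stab N {f (\<alpha> a)} \<longleftrightarrow> \<gamma> \<in> pointwise_stab M {\<alpha> a}"
          using \<gamma> \<alpha>a stab_iff by simp
        also have "\<dots> \<longleftrightarrow> \<beta> \<in> pointwise_stab M {a}"
          unfolding \<gamma>_eq using a \<alpha> \<beta> by (rule M.conj_mem_pointwise_stab_iff)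
        also have "\<dots> \<longleftrightarrow> \<pi> \<beta> \<in> pointwise_stab N {f a}"
          using \<beta> a stab_iff by simp
        also have "\<dots> \<longleftrightarrow> \<delta> \<in> pointwise_stab N {\<pi> \<alpha> (f a)}"
          unfolding \<delta>_eq using a \<alpha> \<beta>
          by (intro N.conj_mem_pointwise_stab_iff[symmetric]) (simp_all add: f(1) \<pi>_aut)
        finally show ?thesis .
      qed (auto simp: pointwise_stab_def)
    qed
  qed
  have conj: "conj_by f M N \<alpha> = \<pi> \<alpha>" if \<alpha>: "\<alpha> \<in> carrier (Aut M)" for \<alpha>
  proof (rule extensionalityI)
    show "conj_by f M N \<alpha> \<in> extensional (universe N)" by (simp add: conj_by_def)
    show "\<pi> \<alpha> \<in> extensional (universe N)"
      using \<alpha> by (intro Bij_imp_extensional N.aut_Bij \<pi>_aut) simp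
    fix y assume "y \<in> universe N"
    then obtain a where "a \<in> universe M" "y = f a" using f_surj by blast
    then show "conj_by f M N \<alpha> y = \<pi> \<alpha> y"
      using \<alpha> f(1) f_inj equivariant by (simp add: conj_by_def)
  qed
  have "conj_by f M N \<in> iso (Aut M) (Aut N)" using \<pi> conj by (rule M.iso_eq)
  then show thesis using that f_bij conj by (auto simp: perm_group_iso_def)
qed

theorem theorem1p1:
  fixes M :: "('a, 'f, 'r) fo_struct" and N :: "('b, 'g, 's) fo_struct"
  assumes "M \<in> K_star" and "N \<in> K_star"
  shows "(Aut M \<cong> Aut N \<longleftrightarrow> (\<exists>f. perm_group_iso M N f)) \<and>
    (\<forall>\<pi> \<in> iso (Aut M) (Aut N).
      \<exists>f. perm_group_iso M N f \<and>
          (\<forall>\<alpha> \<in> carrier (Aut M). \<pi> \<alpha> = conj_by f M N \<alpha>))"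
proof (intro conjI iffI ballI)
  assume "Aut M \<cong> Aut N"
  then show "\<exists>f. perm_group_iso M N f"
    using iso_is_conj_by[OF assms] by (auto simp: is_iso_def)
next
  assume "\<exists>f. perm_group_iso M N f"
  then show "Aut M \<cong> Aut N" by (auto simp: perm_group_iso_def intro: is_isoI)
next
  fix \<pi> assume "\<pi> \<in> iso (Aut M) (Aut N)"
  then show "\<exists>f. perm_group_iso M N f \<and> (\<forall>\<alpha> \<in> carrier (Aut M). \<pi> \<alpha> = conj_by f M N \<alpha>)"
    using iso_is_conj_by[OF assms] by metis
qed

end
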